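(* Let $\mathcal F=\{x_j\}_{j\in J}$ be a frame in a separable real Hilbert space $\mathcal H$ with frame constants $0<A<B$, i.e. $A\|x\|^2\le \sum_{j\in J}|\langle x,x_j\rangle|^2\le B\|x\|^2$ for every $x\in\mathcal H$. Let $S$ be the frame operator of $\mathcal F$ and, for a given $f\in\mathcal H$, let $J_f:\mathcal H\to\mathbb R$, $J_f(u)=\frac12\langle Su,u\rangle-\langle f,u\rangle$. (a) For every $f\in\mathcal H$, $$-\frac{\|f\|^2}{2A}\le \min_{u\in\mathcal H}J_f(u)\le -\frac{\|f\|^2}{2B}.$$ (b) $\mathcal F$ is a Parseval frame if and only if, for every $f\in\mathcal H$, $$\min_{u\in\mathcal H}J_f(u)=-\frac12\|f\|^2 .$$
   Context: $J\subset\mathbb N$ is a nonempty (finite or infinite) index set. A sequence of distinct vectors $\{x_j\}_{j\in J}$ in $\mathcal H$ is a frame if there are constants $A,B>0$ with $A\|x\|^2\le\sum_{j\in J}|\langle x,x_j\rangle|^2\le B\|x\|^2$ for all $x\in\mathcal H$; such $A,B$ are called frame constants (they are not required to be optimal). The frame is Parseval if $\sum_{j\in J}|\langle x,x_j\rangle|^2=\|x\|^2$ for all $x\in\mathcal H$ (i.e. the inequalities hold with both constants equal to $1$). The frame operator is $S:\mathcal H\to\mathcal H$, $Sx=\sum_{j\in J}\langle x,x_j\rangle x_j$. *)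

theory Defs
  imports "HOL-Analysis.Analysis"
begin

text \<open>All sums over the index set are unordered (\<^const>\<open>infsum\<close>).  For the nonnegative scalar
  series this agrees with summation in the order of the natural numbers; the series of the frame
  operator converges unconditionally whenever the family is a frame.  Summability of the scalar
  series is stated explicitly because \<^const>\<open>infsum\<close> is 0 on families that are not summable.\<close>

definition frame_with_constants ::
    "nat set \<Rightarrow> (nat \<Rightarrow> 'a::real_inner) \<Rightarrow> real \<Rightarrow> real \<Rightarrow> bool" where
  "frame_with_constants J x A B \<longleftrightarrow>
     J \<noteq> {} \<and> inj_on x J \<and> 0 < A \<and> 0 < B \<and>
     (\<forall>v. (\<lambda>j. \<bar>inner v (x j)\<bar>\<^sup>2) summable_on J \<and>
          A * (norm v)\<^sup>2 \<le> (\<Sum>\<^sub>\<infinity>j\<in>J. \<bar>inner v (x j)\<bar>\<^sup>2) \<and>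
          (\<Sum>\<^sub>\<infinity>j\<in>J. \<bar>inner v (x j)\<bar>\<^sup>2) \<le> B * (norm v)\<^sup>2)"

definition is_frame :: "nat set \<Rightarrow> (nat \<Rightarrow> 'a::real_inner) \<Rightarrow> bool" where
  "is_frame J x \<longleftrightarrow> (\<exists>A B. frame_with_constants J x A B)"

definition parseval_frame :: "nat set \<Rightarrow> (nat \<Rightarrow> 'a::real_inner) \<Rightarrow> bool" where
  "parseval_frame J x \<longleftrightarrow>
     is_frame J x \<and> (\<forall>v. ((\<lambda>j. \<bar>inner v (x j)\<bar>\<^sup>2) has_sum (norm v)\<^sup>2) J)"

definition frame_operator :: "nat set \<Rightarrow> (nat \<Rightarrow> 'a::real_inner) \<Rightarrow> 'a \<Rightarrow> 'a" where
  "frame_operator J x u = (\<Sum>\<^sub>\<infinity>j\<in>J. inner u (x j) *\<^sub>R x j)"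

definition frame_functional ::
    "nat set \<Rightarrow> (nat \<Rightarrow> 'a::real_inner) \<Rightarrow> 'a \<Rightarrow> 'a \<Rightarrow> real" where
  "frame_functional J x f u = 1 / 2 * inner (frame_operator J x u) u - inner f u"

text \<open>The minimum of \<open>g\<close> over the whole space exists (is attained) and equals \<open>m\<close>.\<close>

definition has_minimum :: "('a \<Rightarrow> real) \<Rightarrow> real \<Rightarrow> bool" where
  "has_minimum g m \<longleftrightarrow> (\<exists>u. is_arg_min g (\<lambda>_. True) u \<and> g u = m)"

end

theory Submission
  imports Defs
begin

text \<open>
  The functional \<open>J\<^sub>f\<close> is the quadratic energy of the linear equation \<open>S u = f\<close>.  The frame operator
  is symmetric with \<open>A \<parallel>u\<parallel>\<^sup>2 \<le> \<langle>S u, u\<rangle> \<le> B \<parallel>u\<parallel>\<^sup>2\<close>, since \<open>\<langle>S u, u\<rangle>\<close> is the sum of the squared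
  frame coefficients of \<open>u\<close>.  Completing the square, \<open>J\<^sub>f\<close> attains its minimum at every solution of
  \<open>S u = f\<close> (\<open>solution_minimizes\<close>), and a solution exists because \<open>u \<mapsto> u - (S u - f) / B\<close> is a
  contraction (\<open>frame_operator_surj\<close>).  This rests on \<open>\<parallel>S u\<parallel>\<^sup>2 \<le> B \<langle>S u, u\<rangle>\<close>.

  For (a), the lower bound holds for every value of \<open>J\<^sub>f\<close>, by coercivity and Cauchy--Schwarz, and the
  upper bound is an estimate of the value at the trial point \<open>f / B\<close>.

  For (b), a Parseval frame has frame constants \<open>1\<close> and \<open>1\<close>, for which the two bounds in (a)
  coincide.  Conversely, comparing the minimum of \<open>J\<^sub>v\<close> with the value at \<open>v\<close> itself gives
  \<open>\<parallel>v\<parallel>\<^sup>2 \<le> \<langle>S v, v\<rangle>\<close>.  For \<open>f = S v\<close> the minimum is \<open>- \<langle>S v, v\<rangle> / 2\<close>, so the hypothesis reads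
  \<open>\<parallel>S v\<parallel>\<^sup>2 = \<langle>S v, v\<rangle>\<close>; by Cauchy--Schwarz \<open>\<parallel>S v\<parallel> \<le> \<parallel>v\<parallel>\<close>, and so \<open>\<langle>S v, v\<rangle> \<le> \<parallel>v\<parallel>\<^sup>2\<close>.
\<close>

locale bessel_family =
  fixes J :: "nat set" and x :: "nat \<Rightarrow> 'a::{real_inner, complete_space}" and B :: real
  assumes B_pos: "0 < B"
    and coeffs_summable: "(\<lambda>j. (inner v (x j))\<^sup>2) summable_on J"
    and bessel: "(\<Sum>\<^sub>\<infinity>j\<in>J. (inner v (x j))\<^sup>2) \<le> B * (norm v)\<^sup>2"
begin

lemma finite_bessel:
  assumes "finite F" "F \<subseteq> J"
  shows "(\<Sum>j\<in>F. (inner v (x j))\<^sup>2) \<le> B * (norm v)\<^sup>2"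
  by (rule order_trans[OF finite_sum_le_infsum[OF coeffs_summable assms] bessel]) simp

text \<open>The synthesis map is the adjoint of the analysis map \<open>v \<mapsto> (\<langle>v, x\<^sub>j\<rangle>)\<^sub>j\<close>, so it has the same
  norm bound.\<close>

lemma finite_synthesis_bound:
  assumes F: "finite F" "F \<subseteq> J"
  shows "(norm (\<Sum>j\<in>F. c j *\<^sub>R x j))\<^sup>2 \<le> B * (\<Sum>j\<in>F. (c j)\<^sup>2)"
proof -
  define y where "y = (\<Sum>j\<in>F. c j *\<^sub>R x j)"
  define d where "d j = inner y (x j)" for j
  have y2: "(norm y)\<^sup>2 = (\<Sum>j\<in>F. c j * d j)"
  proof -
    have "(norm y)\<^sup>2 = inner y (\<Sum>j\<in>F. c j *\<^sub>R x j)"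
      by (simp add: power2_norm_eq_inner flip: y_def)
    then show ?thesis
      by (simp add: inner_sum_right d_def)
  qed
  \<comment> \<open>This square does the work of Cauchy--Schwarz, without a division by \<open>\<parallel>y\<parallel>\<close>.\<close>
  have "0 \<le> (\<Sum>j\<in>F. (B * c j - d j)\<^sup>2)"
    by (simp add: sum_nonneg)
  also have "\<dots> = B\<^sup>2 * (\<Sum>j\<in>F. (c j)\<^sup>2) - 2 * B * (\<Sum>j\<in>F. c j * d j) + (\<Sum>j\<in>F. (d j)\<^sup>2)"
    by (simp add: power2_diff power_mult_distrib sum.distrib sum_subtractf sum_distrib_left mult_ac)
  also have "\<dots> \<le> B\<^sup>2 * (\<Sum>j\<in>F. (c j)\<^sup>2) - 2 * B * (norm y)\<^sup>2 + B * (norm y)\<^sup>2"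
    using finite_bessel[OF F, of y] by (simp add: y2 d_def)
  also have "\<dots> = B * (B * (\<Sum>j\<in>F. (c j)\<^sup>2) - (norm y)\<^sup>2)"
    by (simp add: algebra_simps power2_eq_square)
  finally show ?thesis
    using B_pos by (simp add: y_def zero_le_mult_iff)
qed

text \<open>The tails of \<open>\<Sum> c\<^sub>j\<^sup>2\<close> control those of \<open>\<Sum> c\<^sub>j x\<^sub>j\<close> through the synthesis bound, so the net of
  finite partial sums is Cauchy.  Absolute convergence may fail here.\<close>

lemma synthesis_summable:
  assumes c: "(\<lambda>j. (c j)\<^sup>2) summable_on J"
  shows "(\<lambda>j. c j *\<^sub>R x j) summable_on J"
proof -
  define s where "s = (\<lambda>F. \<Sum>j\<in>F. c j *\<^sub>R x j)"
  have "cauchy_filter (filtermap s (finite_subsets_at_top J))"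
    unfolding cauchy_filter_metric_filtermap
  proof (intro allI impI)
    fix e :: real assume "0 < e"
    \<comment> \<open>A tail of \<open>\<Sum> c\<^sub>j\<^sup>2\<close> of size \<open>\<delta>\<close> moves the partial sum by at most \<open>sqrt (B * \<delta>) < e / 2\<close>.\<close>
    define \<delta> where "\<delta> = (e / 2)\<^sup>2 / (2 * B)"
    have "0 < \<delta>"
      using \<open>0 < e\<close> B_pos by (simp add: \<delta>_def)
    obtain F0 where F0: "finite F0" "F0 \<subseteq> J"
      and close: "dist (\<Sum>j\<in>F0. (c j)\<^sup>2) (\<Sum>\<^sub>\<infinity>j\<in>J. (c j)\<^sup>2) \<le> \<delta>"
      using infsum_finite_approximation[OF c \<open>0 < \<delta>\<close>] by blast
    have near: "dist (s F) (s F0) < e / 2" if F: "finite F" "F0 \<subseteq> F" "F \<subseteq> J" for F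
    proof -
      have "(\<Sum>j\<in>F - F0. (c j)\<^sup>2) = (\<Sum>j\<in>F. (c j)\<^sup>2) - (\<Sum>j\<in>F0. (c j)\<^sup>2)"
        using F by (simp add: sum_diff)
      also have "\<dots> \<le> \<delta>"
        using finite_sum_le_infsum[OF c F(1,3)] close by (simp add: dist_real_def)
      finally have tail: "(\<Sum>j\<in>F - F0. (c j)\<^sup>2) \<le> \<delta>" .
      have "(norm (s F - s F0))\<^sup>2 = (norm (s (F - F0)))\<^sup>2"
        using F by (simp add: s_def sum_diff)
      also have "\<dots> \<le> B * (\<Sum>j\<in>F - F0. (c j)\<^sup>2)"
        unfolding s_def using F by (intro finite_synthesis_bound) auto
      also have "\<dots> \<le> B * \<delta>"
        using tail B_pos by simp
      also have "\<dots> < (e / 2)\<^sup>2"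
        using B_pos \<open>0 < e\<close> by (simp add: \<delta>_def)
      finally show ?thesis
        using \<open>0 < e\<close> power2_less_imp_less[of "norm (s F - s F0)" "e / 2"] by (simp add: dist_norm)
    qed
    show "\<exists>P. eventually P (finite_subsets_at_top J) \<and>
              (\<forall>F G. P F \<and> P G \<longrightarrow> dist (s F) (s G) < e)"
    proof (intro exI conjI allI impI)
      show "\<forall>\<^sub>F F in finite_subsets_at_top J. finite F \<and> F0 \<subseteq> F \<and> F \<subseteq> J"
        unfolding eventually_finite_subsets_at_top using F0 by blast
    next
      fix F G
      assume "(finite F \<and> F0 \<subseteq> F \<and> F \<subseteq> J) \<and> (finite G \<and> F0 \<subseteq> G \<and> G \<subseteq> J)"
      then show "dist (s F) (s G) < e"
        by (blast intro: dist_triangle_half_l[OF near near])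
    qed
  qed
  then have "convergent_filter (filtermap s (finite_subsets_at_top J))"
    by (rule cauchy_filter_convergent)
  then show ?thesis
    by (auto simp: summable_on_def has_sum_def convergent_filter_iff filterlim_def s_def)
qed

lemma frame_operator_has_sum:
  "((\<lambda>j. inner u (x j) *\<^sub>R x j) has_sum frame_operator J x u) J"
  unfolding frame_operator_def
  by (intro has_sum_infsum synthesis_summable coeffs_summable)

lemma inner_frame_operator_has_sum:
  "((\<lambda>j. inner u (x j) * inner v (x j)) has_sum inner (frame_operator J x u) v) J"
  using has_sum_bounded_linear[OF bounded_linear_inner_left[of v] frame_operator_has_sum[of u]]
  by (simp add: o_def inner_commute)

lemma frame_operator_symmetric:
  "inner (frame_operator J x u) v = inner (frame_operator J x v) u"
  using inner_frame_operator_has_sum[of u v] inner_frame_operator_has_sum[of v u]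
  by (simp add: mult.commute has_sum_unique)

lemma frame_operator_quadratic:
  "inner (frame_operator J x u) u = (\<Sum>\<^sub>\<infinity>j\<in>J. (inner u (x j))\<^sup>2)"
  using inner_frame_operator_has_sum[of u u] by (simp add: infsumI power2_eq_square)

lemma frame_operator_nonneg: "0 \<le> inner (frame_operator J x u) u"
  unfolding frame_operator_quadratic by (simp add: infsum_nonneg)

lemma frame_operator_le: "inner (frame_operator J x u) u \<le> B * (norm u)\<^sup>2"
  unfolding frame_operator_quadratic by (rule bessel)

lemma frame_operator_add:
  "frame_operator J x (u + v) = frame_operator J x u + frame_operator J x v"
proof (rule has_sum_unique[OF frame_operator_has_sum])
  show "((\<lambda>j. inner (u + v) (x j) *\<^sub>R x j) has_sum
         frame_operator J x u + frame_operator J x v) J"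
    using has_sum_add[OF frame_operator_has_sum[of u] frame_operator_has_sum[of v]]
    by (simp add: inner_add_left scaleR_add_left)
qed

lemma frame_operator_scaleR: "frame_operator J x (r *\<^sub>R u) = r *\<^sub>R frame_operator J x u"
proof (rule has_sum_unique[OF frame_operator_has_sum])
  show "((\<lambda>j. inner (r *\<^sub>R u) (x j) *\<^sub>R x j) has_sum r *\<^sub>R frame_operator J x u) J"
    using has_sum_bounded_linear[OF bounded_linear_scaleR_right[of r] frame_operator_has_sum[of u]]
    by (simp add: o_def)
qed

lemma frame_operator_diff:
  "frame_operator J x (u - v) = frame_operator J x u - frame_operator J x v"
  using frame_operator_add[of "u - v" v] by (simp add: algebra_simps)

text \<open>This sharpens \<open>\<parallel>S u\<parallel> \<le> B \<parallel>u\<parallel>\<close>: it is what the positivity of the quadratic form at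
  \<open>B u - S u\<close> says once \<open>\<langle>S (S u), S u\<rangle>\<close> is replaced by its upper bound \<open>B \<parallel>S u\<parallel>\<^sup>2\<close>.\<close>

lemma norm_frame_operator_le:
  "(norm (frame_operator J x u))\<^sup>2 \<le> B * inner (frame_operator J x u) u"
proof -
  define y where "y = frame_operator J x u"
  define z where "z = frame_operator J x y"
  have zu: "inner z u = (norm y)\<^sup>2"
    unfolding z_def by (subst frame_operator_symmetric) (simp add: power2_norm_eq_inner flip: y_def)
  have zy: "inner z y \<le> B * (norm y)\<^sup>2"
    unfolding z_def by (rule frame_operator_le)
  have "0 \<le> inner (B *\<^sub>R y - z) (B *\<^sub>R u - y)"
    using frame_operator_nonneg[of "B *\<^sub>R u - y"]
    by (simp add: frame_operator_diff frame_operator_scaleR y_def z_def)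
  also have "\<dots> = B\<^sup>2 * inner y u - 2 * B * (norm y)\<^sup>2 + inner z y"
    unfolding inner_diff_left inner_diff_right inner_scaleR_left inner_scaleR_right zu dot_square_norm
    by (simp add: algebra_simps power2_eq_square)
  also have "\<dots> \<le> B * (B * inner y u - (norm y)\<^sup>2)"
    using zy by (simp add: algebra_simps power2_eq_square)
  finally show ?thesis
    using B_pos by (simp add: y_def zero_le_mult_iff)
qed

text \<open>Completing the square: \<open>J\<^sub>f v - J\<^sub>f u = \<langle>S (v - u), v - u\<rangle> / 2\<close> when \<open>S u = f\<close>.\<close>

lemma solution_minimizes:
  assumes "frame_operator J x u = f"
  shows "has_minimum (frame_functional J x f) (- (1 / 2) * inner f u)"
proof -
  have val: "frame_functional J x f u = - (1 / 2) * inner f u"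
    by (simp add: frame_functional_def assms)
  have "frame_functional J x f u \<le> frame_functional J x f v" for v
  proof -
    have "inner (frame_operator J x v) u = inner f v"
      by (simp add: frame_operator_symmetric[of v u] assms)
    then have "inner (frame_operator J x (v - u)) (v - u)
        = inner (frame_operator J x v) v - 2 * inner f v + inner f u"
      by (simp add: frame_operator_diff assms inner_diff_left inner_diff_right)
    then show ?thesis
      using frame_operator_nonneg[of "v - u"] unfolding val by (simp add: frame_functional_def)
  qed
  then show ?thesis
    unfolding has_minimum_def is_arg_min_def using val by (metis not_less)
qed

end

text \<open>Equal frame constants are admitted, so that Parseval frames are covered with \<open>A = B = 1\<close>.\<close>

locale hilbert_frame = bessel_family J x B
  for J :: "nat set" and x :: "nat \<Rightarrow> 'a::{real_inner, complete_space}" and B :: real +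
  fixes A :: real
  assumes A_pos: "0 < A" and A_le_B: "A \<le> B"
    and lower_bound: "A * (norm v)\<^sup>2 \<le> (\<Sum>\<^sub>\<infinity>j\<in>J. (inner v (x j))\<^sup>2)"
begin

lemma frame_operator_ge: "A * (norm u)\<^sup>2 \<le> inner (frame_operator J x u) u"
  unfolding frame_operator_quadratic by (rule lower_bound)

text \<open>Because \<open>\<parallel>S w\<parallel>\<^sup>2 / B\<^sup>2 \<le> \<langle>S w, w\<rangle> / B\<close>, the square of \<open>\<parallel>w - S w / B\<parallel>\<close> is at most
  \<open>\<parallel>w\<parallel>\<^sup>2 - \<langle>S w, w\<rangle> / B \<le> (1 - A / B) \<parallel>w\<parallel>\<^sup>2\<close>.\<close>

lemma relaxation_contracts:
  "norm (w - (1 / B) *\<^sub>R frame_operator J x w) \<le> sqrt (1 - A / B) * norm w"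
proof -
  define y where "y = frame_operator J x w"
  have "(norm (w - (1 / B) *\<^sub>R y))\<^sup>2 = (norm w)\<^sup>2 - 2 * inner y w / B + (norm y)\<^sup>2 / B\<^sup>2"
    unfolding power2_norm_eq_inner
    by (simp add: inner_diff_left inner_diff_right inner_commute power2_eq_square)
  also have "\<dots> \<le> (norm w)\<^sup>2 - 2 * inner y w / B + (B * inner y w) / B\<^sup>2"
    using norm_frame_operator_le[of w] by (simp add: y_def divide_right_mono)
  also have "\<dots> = (norm w)\<^sup>2 - inner y w / B"
    using B_pos by (simp add: power2_eq_square field_simps)
  also have "\<dots> \<le> (norm w)\<^sup>2 - A * (norm w)\<^sup>2 / B"
    using frame_operator_ge[of w] B_pos by (simp add: y_def divide_right_mono)
  also have "\<dots> = (1 - A / B) * (norm w)\<^sup>2"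
    by (simp add: algebra_simps)
  finally have "sqrt ((norm (w - (1 / B) *\<^sub>R y))\<^sup>2) \<le> sqrt ((1 - A / B) * (norm w)\<^sup>2)"
    by (rule real_sqrt_le_mono)
  then show ?thesis
    by (simp add: real_sqrt_mult y_def)
qed

lemma frame_operator_surj: "\<exists>u. frame_operator J x u = f"
proof -
  define T where "T u = u - (1 / B) *\<^sub>R (frame_operator J x u - f)" for u
  have "dist (T u) (T v) \<le> sqrt (1 - A / B) * dist u v" for u v
  proof -
    have "T u - T v = (u - v) - (1 / B) *\<^sub>R frame_operator J x (u - v)"
      by (simp add: T_def frame_operator_diff algebra_simps)
    then show ?thesis
      using relaxation_contracts[of "u - v"] by (simp add: dist_norm)
  qed
  moreover have "0 \<le> sqrt (1 - A / B)" "sqrt (1 - A / B) < 1"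
    using A_pos A_le_B B_pos by simp_all
  ultimately have "\<exists>!u. T u = u"
    by (intro banach_fix_type[where c = "sqrt (1 - A / B)"]) auto
  then obtain u where "T u = u" by blast
  then show ?thesis
    using B_pos by (auto simp: T_def)
qed

lemma frame_functional_ge: "- ((norm f)\<^sup>2 / (2 * A)) \<le> frame_functional J x f u"
proof -
  have "0 \<le> (A * norm u - norm f)\<^sup>2 / (2 * A)"
    using A_pos by simp
  also have "\<dots> = A * (norm u)\<^sup>2 / 2 - norm f * norm u + (norm f)\<^sup>2 / (2 * A)"
    using A_pos by (simp add: power2_eq_square field_simps)
  finally show ?thesis
    using frame_operator_ge[of u] norm_cauchy_schwarz[of f u] by (simp add: frame_functional_def)
qed

text \<open>The trial point \<open>f / B\<close> minimizes the majorant \<open>B \<parallel>u\<parallel>\<^sup>2 / 2 - \<langle>f, u\<rangle>\<close> of \<open>J\<^sub>f\<close>.\<close>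

lemma frame_functional_trial_le:
  "frame_functional J x f ((1 / B) *\<^sub>R f) \<le> - ((norm f)\<^sup>2 / (2 * B))"
proof -
  have "frame_functional J x f ((1 / B) *\<^sub>R f)
      \<le> 1 / 2 * (B * (norm ((1 / B) *\<^sub>R f))\<^sup>2) - inner f ((1 / B) *\<^sub>R f)"
    unfolding frame_functional_def using frame_operator_le[of "(1 / B) *\<^sub>R f"] by linarith
  also have "\<dots> = 1 / 2 * (B * ((norm f)\<^sup>2 / B\<^sup>2)) - (norm f)\<^sup>2 / B"
    by (simp add: dot_square_norm power_divide)
  also have "\<dots> = - ((norm f)\<^sup>2 / (2 * B))"
    using B_pos by (simp add: power2_eq_square[of B] field_simps)
  finally show ?thesis .
qed

theorem minimum_bounds:
  "\<exists>m. has_minimum (frame_functional J x f) m \<and>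
       - ((norm f)\<^sup>2 / (2 * A)) \<le> m \<and> m \<le> - ((norm f)\<^sup>2 / (2 * B))"
proof -
  obtain u where "frame_operator J x u = f"
    using frame_operator_surj by blast
  then have min: "has_minimum (frame_functional J x f) (- (1 / 2) * inner f u)" (is "has_minimum _ ?m")
    by (rule solution_minimizes)
  then obtain w where w: "frame_functional J x f w = ?m"
    and least: "\<And>v. ?m \<le> frame_functional J x f v"
    unfolding has_minimum_def is_arg_min_def by (metis not_less)
  show ?thesis
    using min frame_functional_ge[of f w] w least[of "(1 / B) *\<^sub>R f"] frame_functional_trial_le[of f]
    by (intro exI[of _ ?m]) linarith
qed

end

lemma has_minimum_le: "has_minimum g m \<Longrightarrow> m \<le> g u"
  unfolding has_minimum_def is_arg_min_def by (metis not_less)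

lemma has_minimum_unique: "has_minimum g m \<Longrightarrow> has_minimum g m' \<Longrightarrow> m = m'"
  by (metis has_minimum_def has_minimum_le order_antisym)

lemma hilbert_frameI:
  fixes x :: "nat \<Rightarrow> 'a::{real_inner, complete_space}"
  assumes "frame_with_constants J x A B" "A \<le> B"
  shows "hilbert_frame J x B A"
  using assms unfolding frame_with_constants_def by unfold_locales auto

lemma parseval_frame_constants:
  assumes "parseval_frame J x"
  shows "frame_with_constants J x 1 1"
  using assms
  by (auto simp: parseval_frame_def is_frame_def frame_with_constants_def has_sum_iff)

text \<open>The inequality \<open>\<ge>\<close> comes from testing the minimum of \<open>J\<^sub>v\<close> at \<open>v\<close>; the inequality \<open>\<le>\<close> comes from
  \<open>J\<^sub>f\<close> with \<open>f = S v\<close>, whose minimizer \<open>v\<close> is known.\<close>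

lemma (in bessel_family) norm_eq_quadratic_if_minimum:
  assumes min: "\<And>f. has_minimum (frame_functional J x f) (- (1 / 2) * (norm f)\<^sup>2)"
  shows "inner (frame_operator J x v) v = (norm v)\<^sup>2"
proof (rule antisym)
  define y where "y = frame_operator J x v"
  have y2: "(norm y)\<^sup>2 = inner y v"
    using has_minimum_unique[OF min[of y] solution_minimizes[of v y]] by (simp add: y_def)
  then have "norm y * norm y \<le> norm y * norm v"
    using norm_cauchy_schwarz[of y v] by (simp add: power2_eq_square)
  then have "norm y \<le> norm v"
    by (cases "norm y = 0") auto
  then show "inner (frame_operator J x v) v \<le> (norm v)\<^sup>2"
    unfolding y_def[symmetric] y2[symmetric] by (rule power_mono) simp
next
  show "(norm v)\<^sup>2 \<le> inner (frame_operator J x v) v"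
    using has_minimum_le[OF min[of v], of v]
    by (simp add: frame_functional_def power2_norm_eq_inner)
qed

theorem theorem3p1:
  fixes J :: "nat set"
    and x :: "nat \<Rightarrow> 'a::{real_inner, complete_space}"
    and A B :: real
  assumes separable: "separable_space (euclidean :: 'a topology)"
    and frame: "frame_with_constants J x A B"
    and "0 < A" and "A < B"
  shows "(\<forall>f. \<exists>m. has_minimum (frame_functional J x f) m \<and>
              - ((norm f)\<^sup>2 / (2 * A)) \<le> m \<and> m \<le> - ((norm f)\<^sup>2 / (2 * B))) \<and>
         (parseval_frame J x \<longleftrightarrow>
            (\<forall>f. has_minimum (frame_functional J x f) (- (1 / 2) * (norm f)\<^sup>2)))"
proof -
  interpret hilbert_frame J x B A
    using frame \<open>A < B\<close> by (intro hilbert_frameI) auto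
  show ?thesis
  proof (intro conjI iffI allI)
    show "\<exists>m. has_minimum (frame_functional J x f) m \<and>
              - ((norm f)\<^sup>2 / (2 * A)) \<le> m \<and> m \<le> - ((norm f)\<^sup>2 / (2 * B))" for f
      by (rule minimum_bounds)
  next
    fix f
    assume "parseval_frame J x"
    then interpret P: hilbert_frame J x 1 1
      by (intro hilbert_frameI parseval_frame_constants) auto
    show "has_minimum (frame_functional J x f) (- (1 / 2) * (norm f)\<^sup>2)"
    proof -
      obtain m where "has_minimum (frame_functional J x f) m"
        and "- ((norm f)\<^sup>2 / 2) \<le> m" "m \<le> - ((norm f)\<^sup>2 / 2)"
        using P.minimum_bounds[of f] by auto
      moreover from this have "m = - (1 / 2) * (norm f)\<^sup>2" by simp
      ultimately show ?thesis by simp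
    qed
  next
    assume "\<forall>f. has_minimum (frame_functional J x f) (- (1 / 2) * (norm f)\<^sup>2)"
    then have "inner (frame_operator J x v) v = (norm v)\<^sup>2" for v
      by (intro norm_eq_quadratic_if_minimum) blast
    then have "((\<lambda>j. \<bar>inner v (x j)\<bar>\<^sup>2) has_sum (norm v)\<^sup>2) J" for v
      using inner_frame_operator_has_sum[of v v] by (simp add: power2_eq_square)
    then show "parseval_frame J x"
      using frame by (auto simp: parseval_frame_def is_frame_def)
  qed
qed

end
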